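(* For any upset $\alpha$ and any argument $\Gamma \rhd \Delta$: the argument $\Gamma \rhd \Delta$ is $\alpha$-materially valid if and only if it is classically valid.
   Context: Language: $\mathcal{L}$ is the propositional language with countably infinitely many atomic sentences and connectives $\neg,\lor$; the connectives $\land,\bot,\top,\supset$ (material conditional) are defined from $\neg,\lor$ as usual, with $\bigwedge\emptyset=\top$ and $\bigvee\emptyset=\bot$. An argument $\Gamma\rhd\Delta$ is a pair of finite (possibly empty) sets $\Gamma,\Delta$ of sentences of $\mathcal{L}$. A probabilistic model is $\langle W,\mathcal{A},[\![\cdot]\!],P\rangle$ where $W$ is a nonempty set (of worlds); $\mathcal{A}\subseteq\mathcal{P}(W)$ contains $\emptyset$ and is closed under complement in $W$ and binary union; $[\![\cdot]\!]:\mathcal{L}\to\mathcal{A}$ satisfies $[\![\neg\phi]\!]=W\setminus[\![\phi]\!]$ and $[\![\phi\lor\psi]\!]=[\![\phi]\!]\cup[\![\psi]\!]$; and $P:\mathcal{A}\to[0,1]$ is a finitely additive probability ($P(\emptyset)=0$, $P(W\setminus A)=1-P(A)$, and $P(A\cup B)=P(A)+P(B)$ for disjoint $A,B\in\mathcal{A}$). Write $P(\phi)$ for $P([\![\phi]\!])$. An upset is a set $\alpha\subseteq[0,1]$ with $1\in\alpha$, $0\notin\alpha$, and such that $x\in\alpha$, $x\le y\le 1$ imply $y\in\alpha$. The argument $\Gamma\rhd\Delta$ is $\alpha$-materially valid iff every probabilistic model satisfies $P(\bigwedge\Gamma\supset\bigvee\Delta)\in\alpha$. It is classically valid iff for every probabilistic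 model and every world $w\in W$, if $w\in[\![\gamma]\!]$ for every $\gamma\in\Gamma$, then $w\in[\![\delta]\!]$ for some $\delta\in\Delta$. *)

theory Defs
  imports "HOL-Analysis.Sigma_Algebra"
begin

datatype sentence = Atom nat | Neg sentence | Or sentence sentence

definition And :: "sentence \<Rightarrow> sentence \<Rightarrow> sentence" where
  "And \<phi> \<psi> = Neg (Or (Neg \<phi>) (Neg \<psi>))"

definition Bot :: sentence where
  "Bot = And (Atom 0) (Neg (Atom 0))"

definition Top :: sentence where
  "Top = Neg Bot"

definition Impl :: "sentence \<Rightarrow> sentence \<Rightarrow> sentence" where
  "Impl \<phi> \<psi> = Or (Neg \<phi>) \<psi>"

fun conj_list :: "sentence list \<Rightarrow> sentence" where
  "conj_list [] = Top"
| "conj_list [\<phi>] = \<phi>"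
| "conj_list (\<phi> # \<psi> # xs) = And \<phi> (conj_list (\<psi> # xs))"

fun disj_list :: "sentence list \<Rightarrow> sentence" where
  "disj_list [] = Bot"
| "disj_list [\<phi>] = \<phi>"
| "disj_list (\<phi> # \<psi> # xs) = Or \<phi> (disj_list (\<psi> # xs))"

(* A conjunction or disjunction of a finite set, as a sentence, requires an ordering of its
   members. An arbitrary one is chosen; Big_And_eq and Big_Or_eq below show that the choice has
   no semantic effect. For infinite sets the value is unspecified. *)
definition enum :: "sentence set \<Rightarrow> sentence list" where
  "enum \<Gamma> = (SOME xs. set xs = \<Gamma> \<and> distinct xs)"

definition Big_And :: "sentence set \<Rightarrow> sentence" where
  "Big_And \<Gamma> = conj_list (enum \<Gamma>)"

definition Big_Or :: "sentence set \<Rightarrow> sentence" where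
  "Big_Or \<Delta> = disj_list (enum \<Delta>)"

(* The library locale algebra says that \<A> is a family of subsets of W that contains {} and is
   closed under complement in W and binary union. Only the values of P on \<A> matter. *)
locale prob_model = algebra W \<A>
  for W :: "'w set" and \<A> :: "'w set set" +
  fixes I :: "sentence \<Rightarrow> 'w set" and P :: "'w set \<Rightarrow> real"
  assumes W_nonempty: "W \<noteq> {}"
    and I_in: "I \<phi> \<in> \<A>"
    and I_Neg: "I (Neg \<phi>) = W - I \<phi>"
    and I_Or: "I (Or \<phi> \<psi>) = I \<phi> \<union> I \<psi>"
    and P_range: "X \<in> \<A> \<Longrightarrow> P X \<in> {0..1}"
    and P_empty: "P {} = 0"
    and P_compl: "X \<in> \<A> \<Longrightarrow> P (W - X) = 1 - P X"
    and P_Un: "X \<in> \<A> \<Longrightarrow> Y \<in> \<A> \<Longrightarrow> X \<inter> Y = {} \<Longrightarrow> P (X \<union> Y) = P X + P Y"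

definition upset :: "real set \<Rightarrow> bool" where
  "upset \<alpha> \<longleftrightarrow> \<alpha> \<subseteq> {0..1} \<and> 1 \<in> \<alpha> \<and> 0 \<notin> \<alpha> \<and>
     (\<forall>x y. x \<in> \<alpha> \<longrightarrow> x \<le> y \<longrightarrow> y \<le> 1 \<longrightarrow> y \<in> \<alpha>)"

(* HOL cannot quantify over all types inside a formula, so the type from which the
   worlds are drawn is an explicit parameter of both notions of validity. *)
definition materially_valid :: "'w itself \<Rightarrow> real set \<Rightarrow> sentence set \<Rightarrow> sentence set \<Rightarrow> bool" where
  "materially_valid (_ :: 'w itself) \<alpha> \<Gamma> \<Delta> \<longleftrightarrow>
     (\<forall>(W :: 'w set) \<A> I P. prob_model W \<A> I P \<longrightarrow> P (I (Impl (Big_And \<Gamma>) (Big_Or \<Delta>))) \<in> \<alpha>)"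

definition classically_valid :: "'w itself \<Rightarrow> sentence set \<Rightarrow> sentence set \<Rightarrow> bool" where
  "classically_valid (_ :: 'w itself) \<Gamma> \<Delta> \<longleftrightarrow>
     (\<forall>(W :: 'w set) \<A> I P. prob_model W \<A> I P \<longrightarrow>
        (\<forall>w\<in>W. (\<forall>\<gamma>\<in>\<Gamma>. w \<in> I \<gamma>) \<longrightarrow> (\<exists>\<delta>\<in>\<Delta>. w \<in> I \<delta>)))"

lemma set_enum: "finite \<Gamma> \<Longrightarrow> set (enum \<Gamma>) = \<Gamma>"
  unfolding enum_def by (metis (mono_tags, lifting) finite_distinct_list someI_ex)

context prob_model
begin

lemma I_subset: "I \<phi> \<subseteq> W"
  using I_in sets_into_space by blast

lemma I_And: "I (And \<phi> \<psi>) = I \<phi> \<inter> I \<psi>"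
  using I_subset[of \<phi>] I_subset[of \<psi>] by (auto simp: And_def I_Neg I_Or)

lemma I_Bot: "I Bot = {}"
  by (auto simp: Bot_def I_And I_Neg)

lemma I_Top: "I Top = W"
  by (simp add: Top_def I_Neg I_Bot)

lemma I_conj_list: "I (conj_list xs) = {w \<in> W. \<forall>\<phi>\<in>set xs. w \<in> I \<phi>}"
  using I_subset by (induction xs rule: conj_list.induct) (auto simp: I_Top I_And)

lemma I_disj_list: "I (disj_list xs) = (\<Union>\<phi>\<in>set xs. I \<phi>)"
  by (induction xs rule: disj_list.induct) (auto simp: I_Bot I_Or)

lemma Big_And_eq: "finite \<Gamma> \<Longrightarrow> I (Big_And \<Gamma>) = {w \<in> W. \<forall>\<gamma>\<in>\<Gamma>. w \<in> I \<gamma>}"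
  by (simp add: Big_And_def I_conj_list set_enum)

lemma Big_Or_eq: "finite \<Delta> \<Longrightarrow> I (Big_Or \<Delta>) = (\<Union>\<delta>\<in>\<Delta>. I \<delta>)"
  by (simp add: Big_Or_def I_disj_list set_enum)

end

end

(* If a world w of some model is a counterexample to the argument, replacing the probability of
   that model by the point mass at w gives the material conditional the probability 0, which lies in
   no upset. Conversely, a classically valid argument has a conditional true at every world. *)
theory Submission
  imports Defs
begin

context prob_model
begin

text \<open>Links the two notions of validity: classical validity says exactly that this set is all
  of \<open>W\<close> in every model.\<close>

lemma I_Impl_Big:
  assumes "finite \<Gamma>" and "finite \<Delta>"
  shows "I (Impl (Big_And \<Gamma>) (Big_Or \<Delta>)) =
    {w \<in> W. (\<forall>\<gamma>\<in>\<Gamma>. w \<in> I \<gamma>) \<longrightarrow> (\<exists>\<delta>\<in>\<Delta>. w \<in> I \<delta>)}"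
  using I_subset by (auto simp: Impl_def I_Neg I_Or Big_And_eq Big_Or_eq assms)

lemma P_space: "P W = 1"
  using P_compl[of "{}"] P_empty by simp

text \<open>Additivity holds because \<open>w\<close> lies in at most one of two disjoint sets; the
  complement rule uses \<open>w \<in> W\<close>. Keeping \<open>W\<close>, \<open>\<A>\<close> and
  \<open>I\<close> preserves the counterexample.\<close>

lemma prob_model_point_mass:
  assumes "w \<in> W"
  shows "prob_model W \<A> I (indicator {X. w \<in> X})"
  by unfold_locales (use assms in \<open>auto simp: I_in I_Neg I_Or indicator_def\<close>)

end

theorem fact9:
  fixes \<alpha> :: "real set" and \<Gamma> \<Delta> :: "sentence set"
  assumes "upset \<alpha>" and "finite \<Gamma>" and "finite \<Delta>"
  shows "materially_valid TYPE('w) \<alpha> \<Gamma> \<Delta> \<longleftrightarrow> classically_valid TYPE('w) \<Gamma> \<Delta>"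
proof
  assume valid: "materially_valid TYPE('w) \<alpha> \<Gamma> \<Delta>"
  show "classically_valid TYPE('w) \<Gamma> \<Delta>"
    unfolding classically_valid_def
  proof (intro allI impI ballI)
    fix W :: "'w set" and \<A> I P w
    assume "prob_model W \<A> I P" and w: "w \<in> W" "\<forall>\<gamma>\<in>\<Gamma>. w \<in> I \<gamma>"
    then interpret prob_model W \<A> I P by simp
    have "indicator {X. w \<in> X} (I (Impl (Big_And \<Gamma>) (Big_Or \<Delta>))) \<in> \<alpha>"
      using valid prob_model_point_mass[OF w(1)] unfolding materially_valid_def by blast
    moreover have "0 \<notin> \<alpha>"
      using assms(1) by (simp add: upset_def)
    \<comment> \<open>The point mass takes only the values 0 and 1, so excluding 0 forces membership
      of \<open>w\<close>.\<close>
    ultimately have "w \<in> I (Impl (Big_And \<Gamma>) (Big_Or \<Delta>))"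
      by (auto simp: indicator_def of_bool_def split: if_splits)
    with w(2) show "\<exists>\<delta>\<in>\<Delta>. w \<in> I \<delta>"
      by (simp add: I_Impl_Big assms)
  qed
next
  assume valid: "classically_valid TYPE('w) \<Gamma> \<Delta>"
  show "materially_valid TYPE('w) \<alpha> \<Gamma> \<Delta>"
    unfolding materially_valid_def
  proof (intro allI impI)
    fix W :: "'w set" and \<A> I P
    assume model: "prob_model W \<A> I P"
    then interpret prob_model W \<A> I P .
    \<comment> \<open>No world is a counterexample, so the conditional gets probability
      \<open>P W = 1\<close>, which every upset contains.\<close>
    have "I (Impl (Big_And \<Gamma>) (Big_Or \<Delta>)) = W"
      using valid model unfolding classically_valid_def I_Impl_Big[OF assms(2,3)] by blast
    then show "P (I (Impl (Big_And \<Gamma>) (Big_Or \<Delta>))) \<in> \<alpha>"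
      using assms(1) by (simp add: P_space upset_def)
  qed
qed

end
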